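(* Let $F(x)=x^{k(q-1)}$ be a power mapping over $\mathbb{F}_{q^2}$, where $q=p^m$, $p$ is an odd prime and $m$, $k$ are positive integers with $\gcd(k,q+1)=1$. Then $F(x)$ is locally-APN. If $q\equiv 2\pmod 3$, its differential spectrum is \[\mathbb{DS}_F=\Big\{\omega_{0}=\tfrac{q^2-1}{2}-(q-1),\ \omega_{1}=3(q-1),\ \omega_{2}=\tfrac{q^2-1}{2}-2q,\ \omega_{3}=2,\ \omega_{q-2}=1\Big\};\] and otherwise its differential spectrum is \[\mathbb{DS}_F=\Big\{\omega_{0}=\tfrac{q^2-1}{2}-(q+1),\ \omega_{1}=3q-1,\ \omega_{2}=\tfrac{q^2-1}{2}-2(q-1),\ \omega_{q-2}=1\Big\}.\]
   Context: For a function $F:\mathbb{F}_{p^n}\to\mathbb{F}_{p^n}$ ($p$ prime), $a\in\mathbb{F}_{p^n}^*$ and $b\in\mathbb{F}_{p^n}$, let $\delta_F(a,b)=|\{x\in\mathbb{F}_{p^n}: F(x+a)-F(x)=b\}|$, and let $\delta(F)=\max_{a\in\mathbb{F}_{p^n}^*}\max_{b\in\mathbb{F}_{p^n}}\delta_F(a,b)$. Here $n=2m$, so $\mathbb{F}_{p^n}=\mathbb{F}_{q^2}$. For a power mapping $F$ with $\delta(F)=\delta$, the differential spectrum is $\mathbb{DS}_F=\{\omega_0,\omega_1,\ldots,\omega_\delta\}$, where $\omega_i=|\{b\in\mathbb{F}_{p^n}:\delta_F(1,b)=i\}|$ for $0\le i\le\delta$; entries not displayed are zero. A power function $F$ over $\mathbb{F}_{p^n}$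 is said to be locally-APN if $\max\{\delta_F(1,b): b\in\mathbb{F}_{p^n}\setminus\mathbb{F}_p\}=2$.
   Formalization: Locally-APN is claimed only for q ≠ 3, since for q = 3 the map F is planar (all δ_F(1,b) = 1, so the maximum is 1, not 2); where displayed indices coincide (q = 3: ω_1; q = 5: ω_3), the displayed entries are added. *)

theory Defs
  imports "HOL-Computational_Algebra.Primes"
begin

definition delta_count :: "('a::{field,finite} \<Rightarrow> 'a) \<Rightarrow> 'a \<Rightarrow> 'a \<Rightarrow> nat" where
  "delta_count F a b = card {x. F (x + a) - F x = b}"

definition differential_uniformity :: "('a::{field,finite} \<Rightarrow> 'a) \<Rightarrow> nat" where
  "differential_uniformity F = (MAX a\<in>UNIV - {0}. MAX b\<in>UNIV. delta_count F a b)"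

definition omega :: "('a::{field,finite} \<Rightarrow> 'a) \<Rightarrow> nat \<Rightarrow> nat" where
  "omega F i = card {b. delta_count F 1 b = i}"

(* The spectrum is the indexed family (omega 0, ..., omega delta), zero entries included, so its
   length also records the differential uniformity delta. *)
definition differential_spectrum :: "('a::{field,finite} \<Rightarrow> 'a) \<Rightarrow> nat list" where
  "differential_spectrum F = map (omega F) [0..<Suc (differential_uniformity F)]"

(* In a field of characteristic p, \<int> (the image of the integers) is the prime subfield F_p. *)
definition locally_APN :: "('a::{field,finite} \<Rightarrow> 'a) \<Rightarrow> bool" where
  "locally_APN F \<longleftrightarrow> (MAX b\<in>UNIV - \<int>. delta_count F 1 b) = 2"

(* The family indexed by 0, ..., d that is displayed as a list of pairs (index, entry).  Entries not
   displayed are zero.  Entries displayed under the same index are added: a display with indices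
   0, 1, 2, 3, q - 2 repeats an index when q = 3 or q = 5. *)
definition displayed_spectrum :: "nat \<Rightarrow> (nat \<times> nat) list \<Rightarrow> nat list" where
  "displayed_spectrum d es = map (\<lambda>i. \<Sum>(j, w)\<leftarrow>es. if j = i then w else 0) [0..<Suc d]"

end

theory Submission
  imports Defs "HOL-Computational_Algebra.Polynomial" "HOL-Number_Theory.Cong"
begin

text \<open>
  Let \<open>U\<close> be the group of \<open>(q + 1)\<close>-th roots of unity in the field with \<open>q\<^sup>2\<close> elements. On nonzero
  arguments \<open>F\<close> takes values in \<open>U\<close>, it is \<open>1\<close> exactly on the nonzero elements of the subfield with
  \<open>q\<close> elements, and \<open>x \<mapsto> (F (x + 1), F x)\<close> maps the complement of that subfield bijectively onto
  the pairs \<open>(u, v)\<close> of distinct elements of \<open>U - {1}\<close>: for \<open>k = 1\<close> the inverse is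
  \<open>(u, v) \<mapsto> (u - 1) / (v - u)\<close>, and the \<open>k\<close>-th power permutes \<open>U\<close>. So one has to count the pairs
  with \<open>u - v = b\<close>. Raising to the \<open>q\<close>-th power shows that \<open>b \<noteq> 0\<close> determines the product \<open>u v\<close>, hence
  the pair up to \<open>(u, v) \<mapsto> (- v, - u)\<close>. This leaves one pair when \<open>v = - u\<close> or one of \<open>u, v\<close> is
  \<open>-1\<close>, and two otherwise. The subfield contributes \<open>q - 2\<close> solutions to \<open>b = 0\<close> and one
  each to \<open>b = 1\<close> and \<open>b = -1\<close>; finally \<open>u - v = 1\<close> forces \<open>u v = -1\<close> and \<open>u\<^sup>2 - u + 1 = 0\<close>, which has
  an admissible solution exactly when \<open>3\<close> divides \<open>q + 1\<close>.
\<close>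

subsection \<open>Finite fields and their roots of unity\<close>

text \<open>Multiplication by \<open>x\<close> permutes the nonzero elements, so their product
  absorbs the factor \<open>x ^ (card UNIV - 1)\<close>.\<close>

lemma finite_field_power_card_minus_one:
  fixes x :: "'a::{field,finite}"
  assumes "x \<noteq> 0"
  shows "x ^ (card (UNIV :: 'a set) - 1) = 1"
proof -
  have "(\<Prod>y\<in>UNIV-{0}. x * y) = (\<Prod>y\<in>UNIV-{0}. y)"
    by (rule prod.reindex_bij_witness[of _ "\<lambda>y. y / x" "\<lambda>y. x * y"]) (use assms in auto)
  then have "x ^ (card (UNIV :: 'a set) - 1) * \<Prod>(UNIV-{0}) = \<Prod>(UNIV-{0::'a})"
    by (simp add: prod.distrib)
  then show ?thesis by simp
qed

lemma card_nth_roots_le: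
  fixes a :: "'a::idom"
  assumes "n > 0"
  shows "card {x. x ^ n = a} \<le> n"
proof -
  let ?p = "monom 1 n - [:a:]"
  have deg: "degree ?p = n"
    using degree_add_eq_left[of "[:-a:]" "monom 1 n"] assms
    by (simp add: degree_monom_eq diff_conv_add_uminus del: add_uminus_conv_diff)
  then have "?p \<noteq> 0" using assms by auto
  then have "card {x. poly ?p x = 0} \<le> n"
    using card_poly_roots_bound[of ?p] deg by simp
  then show ?thesis by (simp add: poly_monom)
qed

text \<open>A double count replaces the cyclicity of the multiplicative group: the
  \<open>d\<close>-th power sends the \<open>n * d\<close> nonzero elements into the
  \<open>n\<close>-th roots of unity with fibres of size at most \<open>d\<close>, so there are at
  least \<open>n\<close> such roots.\<close>

lemma card_roots_of_unity_finite_field: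
  assumes "n * d = card (UNIV :: 'a::{field,finite} set) - 1"
  shows "card {x :: 'a. x ^ n = 1} = n"
proof -
  have "card {0, 1 :: 'a} \<le> card (UNIV :: 'a set)" by (rule card_mono) auto
  then have pos: "n > 0" "d > 0" using assms by (auto intro!: gr0I)
  let ?R = "{x :: 'a. x ^ n = 1}" and ?N = "UNIV - {0 :: 'a}"
  have sub: "(\<lambda>x. x ^ d) ` ?N \<subseteq> ?R"
    using finite_field_power_card_minus_one assms
    by (auto simp: power_mult[symmetric] mult.commute)
  have "n * d = card ?N" using assms by simp
  also have "\<dots> = (\<Sum>y\<in>?R. card {x \<in> ?N. x ^ d = y})"
    using sum.group[of ?N ?R "\<lambda>x. x ^ d" "\<lambda>_. 1::nat"] sub by simp
  also have "\<dots> \<le> (\<Sum>y\<in>?R. d)"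
  proof (rule sum_mono)
    fix y
    have "card {x \<in> ?N. x ^ d = y} \<le> card {x. x ^ d = y}" by (rule card_mono) auto
    also have "\<dots> \<le> d" using pos(2) by (rule card_nth_roots_le)
    finally show "card {x \<in> ?N. x ^ d = y} \<le> d" .
  qed
  finally have "n \<le> card ?R" using pos by simp
  then show ?thesis using card_nth_roots_le[OF pos(1), of "1::'a"] by simp
qed

text \<open>If \<open>j\<close> inverts \<open>k\<close> modulo \<open>n\<close>, the
  \<open>j\<close>-th power undoes the \<open>k\<close>-th power on \<open>n\<close>-th roots of
  unity.\<close>

lemma power_inj_on_roots_of_unity:
  fixes x y :: "'a::field"
  assumes "coprime k n" and "n > 0" and "x ^ n = 1" and "y ^ n = 1" and "x ^ k = y ^ k"
  shows "x = y"
proof (cases "n = 1")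
  case False
  then obtain j where j: "[k * j = Suc 0] (mod n)"
    using cong_solve_coprime_nat[of k n] assms(1) by auto
  have inv: "z ^ (k * j) = z" if "z ^ n = 1" for z :: 'a
  proof -
    have red: "z ^ i = z ^ (i mod n)" for i
    proof -
      have "z ^ i = z ^ (n * (i div n) + i mod n)" by simp
      also have "\<dots> = z ^ (i mod n)" using that by (simp only: power_add power_mult) simp
      finally show ?thesis .
    qed
    show ?thesis using red[of "k * j"] red[of 1] j by (simp add: cong_def)
  qed
  show ?thesis using inv[OF assms(3)] inv[OF assms(4)] assms(5) by (metis power_mult)
qed (use assms in simp)

text \<open>The translation by 1 permutes the field, so summing all elements shows that the
  cardinality vanishes in the field. Hence the characteristic is a prime dividing a power of
  \<open>p\<close>, that is, \<open>p\<close> itself.\<close>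

lemma finite_field_frobenius:
  fixes x y :: "'a::{field,finite}"
  assumes "prime p" and "card (UNIV :: 'a set) = (p ^ m) ^ 2"
  shows "(x + y) ^ (p ^ m) = x ^ (p ^ m) + y ^ (p ^ m)"
proof -
  have "(\<Sum>x\<in>UNIV. x) = (\<Sum>x\<in>UNIV. x + 1 :: 'a)"
    by (rule sum.reindex_bij_witness[of _ "\<lambda>x. x + 1" "\<lambda>x. x - 1"]) auto
  then have "of_nat (card (UNIV :: 'a set)) = (0 :: 'a)" by (simp add: sum.distrib)
  then have "CHAR('a) dvd p ^ (m * 2)"
    using assms(2) by (simp add: of_nat_eq_0_iff_char_dvd power_mult del: of_nat_power)
  moreover have "prime CHAR('a)"
    by (rule prime_CHAR_semidom) (rule finite_imp_CHAR_pos, simp)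
  ultimately have "CHAR('a) = p"
    using assms(1) by (metis prime_dvd_power primes_dvd_imp_eq)
  then show ?thesis using freshmans_dream'[of "p ^ m" m x y] assms(1) by simp
qed

subsection \<open>Counting values of power functions\<close>

text \<open>Substituting \<open>x * a\<close> for the variable pulls out the factor
  \<open>a ^ d\<close>, so for power functions the direction \<open>a = 1\<close> determines all
  others.\<close>

lemma delta_count_power_scale:
  fixes a b :: "'a::{field,finite}"
  assumes "a \<noteq> 0"
  shows "delta_count (\<lambda>x. x ^ d) a b = delta_count (\<lambda>x. x ^ d) 1 (b / a ^ d)"
proof -
  have key: "((x * a + a) ^ d - (x * a) ^ d = b) \<longleftrightarrow> ((x + 1) ^ d - x ^ d = b / a ^ d)" for x
  proof -
    have "(x * a + a) ^ d - (x * a) ^ d = ((x + 1) ^ d - x ^ d) * a ^ d"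
      by (simp add: algebra_simps flip: power_mult_distrib)
    then show ?thesis using assms by (simp add: eq_divide_eq)
  qed
  let ?A = "{x. (x + 1) ^ d - x ^ d = b / a ^ d}"
  have "{y. (y + a) ^ d - y ^ d = b} = (\<lambda>x. x * a) ` ?A"
  proof (intro set_eqI iffI)
    fix y assume "y \<in> {y. (y + a) ^ d - y ^ d = b}"
    then show "y \<in> (\<lambda>x. x * a) ` ?A"
      using key[of "y / a"] assms by (intro image_eqI[of _ _ "y / a"]) simp_all
  next
    fix y assume "y \<in> (\<lambda>x. x * a) ` ?A"
    then obtain x where "x \<in> ?A" "y = x * a" by blast
    then show "y \<in> {y. (y + a) ^ d - y ^ d = b}" using key[of x] by simp
  qed
  moreover have "inj_on (\<lambda>x. x * a) ?A" using assms by (simp add: inj_on_def)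
  ultimately show ?thesis unfolding delta_count_def by (simp add: card_image)
qed

lemma differential_uniformity_power:
  fixes b\<^sub>0 :: "'a::{field,finite}"
  assumes "delta_count (\<lambda>x. x ^ d) 1 b\<^sub>0 = n"
    and "\<And>b :: 'a. delta_count (\<lambda>x. x ^ d) 1 b \<le> n"
  shows "differential_uniformity (\<lambda>x :: 'a. x ^ d) = n"
proof -
  let ?\<delta> = "delta_count (\<lambda>x :: 'a. x ^ d)"
  have "(MAX b\<in>UNIV. ?\<delta> a b) = n" if "a \<noteq> 0" for a
  proof (rule Max_eqI)
    have "?\<delta> a (b\<^sub>0 * a ^ d) = n"
      using assms(1) that delta_count_power_scale[OF that, of d "b\<^sub>0 * a ^ d"] by simp
    then show "n \<in> range (?\<delta> a)" by (metis rangeI)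
  qed (use assms(2) delta_count_power_scale[OF that, of d] in auto)
  then have "(\<lambda>a. MAX b\<in>UNIV. ?\<delta> a b) ` (UNIV - {0}) = {n}"
    using zero_neq_one[where 'a = 'a] by (auto intro!: image_eqI[of _ _ 1])
  then show ?thesis unfolding differential_uniformity_def by simp
qed

section \<open>Spectra read off from a partition into level sets\<close>

text \<open>A pair \<open>(j, A)\<close> is a block on which \<open>f\<close> is constantly
  \<open>j\<close>. Indices may repeat and blocks may be empty; equal indices are added as in
  \<open>displayed_spectrum\<close>, which matters when \<open>q - 2\<close> is 1 or 3.\<close>

lemma card_level_set_blocks:
  fixes f :: "'b::finite \<Rightarrow> nat"
  assumes "sorted_wrt (\<lambda>(i, A) (j, B). A \<inter> B = {}) bs"
    and "\<And>j A b. (j, A) \<in> set bs \<Longrightarrow> b \<in> A \<Longrightarrow> f b = j"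
  shows "card {b \<in> \<Union>(snd ` set bs). f b = i} = (\<Sum>(j, A)\<leftarrow>bs. if j = i then card A else 0)"
  using assms
proof (induction bs)
  case (Cons jA bs)
  obtain j A where [simp]: "jA = (j, A)" by fastforce
  have IH: "card {b \<in> \<Union>(snd ` set bs). f b = i} = (\<Sum>(j, A)\<leftarrow>bs. if j = i then card A else 0)"
    using Cons.prems by (intro Cons.IH) auto
  have disj: "A \<inter> \<Union>(snd ` set bs) = {}" using Cons.prems(1) by fastforce
  have "f b = j" if "b \<in> A" for b using Cons.prems(2)[of j A b] that by simp
  then have "{b \<in> \<Union>(snd ` set (jA # bs)). f b = i} =
      (if j = i then A else {}) \<union> {b \<in> \<Union>(snd ` set bs). f b = i}"
    by auto
  also have "card \<dots> = card (if j = i then A else {}) + card {b \<in> \<Union>(snd ` set bs). f b = i}"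
    using disj by (intro card_Un_disjoint) auto
  finally show ?case using IH by simp
qed simp

lemma differential_spectrum_eq_displayed_spectrum:
  assumes "differential_uniformity F = d"
    and "sorted_wrt (\<lambda>(i, A) (j, B). A \<inter> B = {}) bs"
    and "\<And>j A b. (j, A) \<in> set bs \<Longrightarrow> b \<in> A \<Longrightarrow> delta_count F 1 b = j"
    and "\<Union>(snd ` set bs) = UNIV"
  shows "differential_spectrum F = displayed_spectrum d (map (\<lambda>(j, A). (j, card A)) bs)"
proof -
  have "omega F i = (\<Sum>(j, w)\<leftarrow>map (\<lambda>(j, A). (j, card A)) bs. if j = i then w else 0)" for i
    using card_level_set_blocks[OF assms(2,3), where i = i] assms(4)
    by (simp add: omega_def case_prod_unfold comp_def cong: if_cong)
  then show ?thesis using assms(1) by (simp add: differential_spectrum_def displayed_spectrum_def)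
qed

lemma disjoint_blocks_special_in_Y:
  assumes "X \<inter> Y = {}" "z \<notin> X" "z \<notin> Y" "a \<in> Y" "b \<in> Y"
  shows "sorted_wrt (\<lambda>(i, A) (j, B). A \<inter> B = {})
    [(i0, UNIV - (X \<union> (Y \<union> {z}))), (i1, X), (i2, Y - {a, b}), (i3, {a, b}), (i4, {z})]"
  using assms by auto

lemma disjoint_blocks_special_outside:
  assumes "X \<inter> Y = {}" "z \<notin> X" "z \<notin> Y" "a \<notin> Y" "b \<notin> Y" "z \<noteq> a" "z \<noteq> b"
  shows "sorted_wrt (\<lambda>(i, A) (j, B). A \<inter> B = {})
    [(i0, UNIV - (X \<union> (Y \<union> {z, a, b}))), (i1, X \<union> {a, b}), (i2, Y), (i3, {z})]"
  using assms by auto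

subsection \<open>Differences of roots of unity\<close>

text \<open>\<open>U\<close> is the kernel of the norm onto the subfield with \<open>q\<close>
  elements. Additivity of the \<open>q\<close>-th power is an assumption, so that the characteristic
  never enters explicitly.\<close>

locale quadratic_extension =
  fixes q :: nat and U :: "'a::{field,finite} set"
  defines "U \<equiv> {u. u ^ (q + 1) = 1}"
  assumes card_field: "card (UNIV :: 'a set) = q ^ 2"
    and odd_q: "odd q" and q_ge_3: "q \<ge> 3"
    and frobenius: "\<And>x y :: 'a. (x + y) ^ q = x ^ q + y ^ q"
begin

text \<open>As \<open>q ^ 2 - 1\<close> is even, there are two square roots of 1.\<close>

lemma minus_one_neq_one: "(-1 :: 'a) \<noteq> 1"
proof
  assume *: "(-1 :: 'a) = 1"
  have "even (q ^ 2 - 1)" using odd_q by simp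
  then have "card {x :: 'a. x ^ 2 = 1} = 2"
    using card_field
    by (intro card_roots_of_unity_finite_field[where d = "(q ^ 2 - 1) div 2"]) simp
  moreover have "{x :: 'a. x ^ 2 = 1} = {1}"
    using * by (auto simp: power2_eq_1_iff)
  ultimately show False by simp
qed

lemma neq_uminus: "(x :: 'a) \<noteq> 0 \<Longrightarrow> x \<noteq> - x"
  using minus_one_neq_one by (metis mult_cancel_right mult_minus1 mult_1)

lemma q_square_minus_one: "(q + 1) * (q - 1) = q ^ 2 - 1"
  by (simp add: power2_eq_square algebra_simps)

lemma card_U: "card U = q + 1"
  unfolding U_def
  using card_field q_square_minus_one by (intro card_roots_of_unity_finite_field[where d = "q - 1"]) simp

lemma power_eq_if_neq_zero: "(x :: 'a) \<noteq> 0 \<Longrightarrow> x ^ q = x ^ (q - 1) * x"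
  using q_ge_3 by (cases q) (auto simp: mult.commute)

lemma subfield_eq: "{x :: 'a. x ^ q = x} = insert 0 {x. x ^ (q - 1) = 1}"
proof -
  have "x ^ q = x \<longleftrightarrow> x = 0 \<or> x ^ (q - 1) = 1" for x :: 'a
    using power_eq_if_neq_zero[of x] q_ge_3 by (cases "x = 0") (simp_all add: zero_power)
  then show ?thesis by auto
qed

lemma card_subfield: "card {x :: 'a. x ^ q = x} = q"
proof -
  have "card {x :: 'a. x ^ (q - 1) = 1} = q - 1"
    using card_field q_square_minus_one
    by (intro card_roots_of_unity_finite_field[where d = "q + 1"]) (simp add: mult.commute)
  then show ?thesis using q_ge_3 unfolding subfield_eq by (simp add: zero_power)
qed

lemma frobenius_uminus: "(- x :: 'a) ^ q = - (x ^ q)"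
  using odd_q by simp

lemma frobenius_diff: "(x - y :: 'a) ^ q = x ^ q - y ^ q"
  using frobenius[of x "- y"] by (simp add: frobenius_uminus)

lemma power_in_U: "(x :: 'a) \<noteq> 0 \<Longrightarrow> x ^ (q - 1) \<in> U"
  using finite_field_power_card_minus_one[of x] card_field q_square_minus_one
  unfolding U_def by (simp add: power_mult[symmetric] mult.commute del: power_Suc)

lemma U_nonzero: "u \<in> U \<Longrightarrow> u \<noteq> 0"
  by (auto simp: U_def)

lemma U_inverse: "u \<in> U \<Longrightarrow> u ^ q = inverse u"
  using U_nonzero[of u] by (auto simp: U_def field_simps)

lemma uminus_in_U: "- u \<in> U \<longleftrightarrow> u \<in> U"
  using odd_q by (auto simp: U_def)

lemma one_in_U: "1 \<in> U"
  by (simp add: U_def)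

lemma Ints_subset_subfield: "\<int> \<subseteq> {x :: 'a. x ^ q = x}"
proof -
  have nat: "of_nat n ^ q = (of_nat n :: 'a)" for n
    using q_ge_3 by (induction n) (auto simp: frobenius zero_power)
  have "of_int z ^ q = (of_int z :: 'a)" for z
    by (cases z rule: int_cases2) (auto simp: nat frobenius_uminus)
  then show ?thesis by (auto simp: Ints_def)
qed

section \<open>Admissible pairs and the fibres of the difference map\<close>

definition W :: "'a set" where "W = U - {1, -1}"
definition admissible_pairs :: "('a \<times> 'a) set" where
  "admissible_pairs = {(u, v). u \<in> U - {1} \<and> v \<in> U - {1} \<and> u \<noteq> v}"
text \<open>These are the pairs that have no second admissible partner under the involution
  \<open>(u, v) \<mapsto> (- v, - u)\<close>: it fixes those with \<open>v = - u\<close>, and it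
  sends those with an entry -1 to pairs with an entry 1.\<close>

definition single_pairs :: "('a \<times> 'a) set" where
  "single_pairs = (\<lambda>u. (u, - u)) ` W \<union> (\<lambda>u. (u, -1)) ` W \<union> (\<lambda>v. (-1, v)) ` W"
definition double_pairs :: "('a \<times> 'a) set" where
  "double_pairs = {(u, v). u \<in> W \<and> v \<in> W \<and> u \<noteq> v \<and> u \<noteq> - v}"

abbreviation D :: "'a \<times> 'a \<Rightarrow> 'a" where "D \<equiv> (\<lambda>(u, v). u - v)"

lemma card_W: "card W = q - 1"
  using card_U minus_one_neq_one one_in_U uminus_in_U[of 1]
  unfolding W_def by (subst card_Diff_subset) auto

lemma W_D: "u \<in> W \<Longrightarrow> u \<in> U \<and> u \<noteq> 1 \<and> u \<noteq> -1 \<and> - u \<noteq> 1"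
  unfolding W_def by (metis Diff_iff insert_iff minus_minus)

lemma uminus_in_W: "u \<in> W \<Longrightarrow> - u \<in> W"
  unfolding W_def by (metis Diff_iff insert_iff empty_iff minus_minus uminus_in_U)

lemma admissible_pairs_eq: "admissible_pairs = single_pairs \<union> double_pairs"
proof (intro set_eqI iffI)
  fix s assume "s \<in> admissible_pairs"
  then obtain u v where s: "s = (u, v)" "u \<in> U" "v \<in> U" "u \<noteq> 1" "v \<noteq> 1" "u \<noteq> v"
    by (auto simp: admissible_pairs_def)
  then show "s \<in> single_pairs \<union> double_pairs"
    by (cases "u = -1"; cases "v = -1"; cases "v = - u") (auto simp: single_pairs_def double_pairs_def W_def)
next
  have intro: "(u, v) \<in> admissible_pairs" if "u \<in> U" "v \<in> U" "u \<noteq> 1" "v \<noteq> 1" "u \<noteq> v" for u v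
    using that by (simp add: admissible_pairs_def)
  have minus_one: "-1 \<in> U" using uminus_in_U[of 1] one_in_U by simp
  fix s assume "s \<in> single_pairs \<union> double_pairs"
  then consider u where "u \<in> W" "s = (u, - u)" | u where "u \<in> W" "s = (u, -1)"
    | u where "u \<in> W" "s = (-1, u)" | u v where "u \<in> W" "v \<in> W" "u \<noteq> v" "s = (u, v)"
    by (auto simp: single_pairs_def double_pairs_def)
  then show "s \<in> admissible_pairs"
  proof cases
    case (1 u)
    then show ?thesis
      using W_D[of u] uminus_in_U[of u] neq_uminus[OF U_nonzero, of u] intro by blast
  next
    case (2 u)
    then show ?thesis using W_D[of u] minus_one minus_one_neq_one intro by blast
  next
    case (3 u)
    then show ?thesis using W_D[of u] minus_one minus_one_neq_one intro by metis
  next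
    case (4 u v)
    then show ?thesis using W_D[of u] W_D[of v] intro by blast
  qed
qed

lemma single_double_pairs_disjoint: "single_pairs \<inter> double_pairs = {}"
  by (auto simp: single_pairs_def double_pairs_def W_def)

text \<open>From \<open>u - v = b\<close> one gets \<open>b ^ q = - b / (u * v)\<close>, so \<open>b\<close> determines both the sum and the
  product of \<open>u\<close> and \<open>- v\<close>.\<close>
lemma frobenius_diff_U:
  assumes "u \<in> U" "v \<in> U"
  shows "(u - v) ^ q * (u * v) = - (u - v)"
  using U_nonzero[OF assms(1)] U_nonzero[OF assms(2)]
  by (simp add: frobenius_diff U_inverse assms field_simps)

lemma diff_eq_iff_U:
  assumes "u \<in> U" "v \<in> U" "u' \<in> U" "v' \<in> U" "u \<noteq> v"
  shows "u - v = u' - v' \<longleftrightarrow> (u', v') = (u, v) \<or> (u', v') = (- v, - u)"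
proof
  assume eq: "u - v = u' - v'"
  have "(u - v) ^ q * (u * v) = (u - v) ^ q * (u' * v')"
    using frobenius_diff_U[OF assms(1,2)] frobenius_diff_U[OF assms(3,4)] eq by simp
  then have "u * v = u' * v'" using assms(5) by simp
  moreover have v': "v' = u' - u + v" using eq by (simp add: algebra_simps)
  \<comment> \<open>Equal sum and product: \<open>u'\<close> is a root of the quadratic with roots
    \<open>u\<close> and \<open>- v\<close>.\<close>
  ultimately have "(u' - u) * (u' + v) = 0" by (simp add: algebra_simps)
  then show "(u', v') = (u, v) \<or> (u', v') = (- v, - u)"
    using v' by (auto simp: add_eq_0_iff)
qed auto

lemma admissible_pair_D: "(u, v) \<in> admissible_pairs \<Longrightarrow> u \<in> U \<and> v \<in> U \<and> u \<noteq> v"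
  by (auto simp: admissible_pairs_def)

lemma D_fibre:
  assumes "(u, v) \<in> admissible_pairs"
  shows "{t \<in> admissible_pairs. D t = u - v} = {(u, v), (- v, - u)} \<inter> admissible_pairs"
proof -
  have "D t = u - v \<longleftrightarrow> t \<in> {(u, v), (- v, - u)}" if "t \<in> admissible_pairs" for t
    using diff_eq_iff_U[of u v "fst t" "snd t"] admissible_pair_D[OF assms]
      admissible_pair_D[of "fst t" "snd t"] that
    by (cases t) auto
  then show ?thesis by blast
qed

lemma D_fibre_single:
  assumes "s \<in> single_pairs"
  shows "{t \<in> admissible_pairs. D t = D s} = {s}"
proof -
  obtain u v where s: "s = (u, v)" by fastforce
  have "s \<in> admissible_pairs" using assms admissible_pairs_eq by auto
  moreover have "(- v, - u) = (u, v) \<or> (- v, - u) \<notin> admissible_pairs"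
    using assms s by (auto simp: single_pairs_def admissible_pairs_def)
  ultimately show ?thesis using D_fibre[of u v] s by auto
qed

lemma D_fibre_double:
  assumes "(u, v) \<in> double_pairs"
  shows "{t \<in> admissible_pairs. D t = u - v} = {(u, v), (- v, - u)}"
    "{t \<in> double_pairs. D t = u - v} = {(u, v), (- v, - u)}"
    "(u, v) \<noteq> (- v, - u)"
proof -
  have "(- v, - u) \<in> double_pairs"
    using assms by (auto simp: double_pairs_def uminus_in_W)
  then show "{t \<in> admissible_pairs. D t = u - v} = {(u, v), (- v, - u)}"
    using assms D_fibre[of u v] admissible_pairs_eq by blast
  then show "{t \<in> double_pairs. D t = u - v} = {(u, v), (- v, - u)}"
    using assms \<open>(- v, - u) \<in> double_pairs\<close> admissible_pairs_eq by blast
  show "(u, v) \<noteq> (- v, - u)" using assms by (auto simp: double_pairs_def)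
qed

lemma inj_on_D_single_pairs: "inj_on D single_pairs"
proof (rule inj_onI)
  fix s t assume "s \<in> single_pairs" "t \<in> single_pairs" "D s = D t"
  then show "s = t" using D_fibre_single[of s] admissible_pairs_eq by auto
qed

lemma D_image_disjoint: "D ` single_pairs \<inter> D ` double_pairs = {}"
proof -
  have False if "s \<in> single_pairs" "t \<in> double_pairs" "D s = D t" for s t
    using that D_fibre_single[of s] admissible_pairs_eq single_double_pairs_disjoint by auto
  then show ?thesis by blast
qed

lemma zero_notin_D_image: "0 \<notin> D ` admissible_pairs"
  by (auto simp: admissible_pairs_def)

lemma card_D_single_pairs: "card (D ` single_pairs) = 3 * (q - 1)"
proof -
  let ?A = "(\<lambda>u. (u, - u)) ` W" and ?B = "(\<lambda>u. (u, -1 :: 'a)) ` W" and ?C = "(\<lambda>v. (-1 :: 'a, v)) ` W"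
  have "card ?A = card W" "card ?B = card W" "card ?C = card W"
    by (auto intro!: card_image inj_onI)
  moreover have "?A \<inter> ?B = {}" "(?A \<union> ?B) \<inter> ?C = {}"
    by (auto simp: W_def)
  ultimately have "card single_pairs = card W + card W + card W"
    unfolding single_pairs_def by (simp add: card_Un_disjoint)
  then show ?thesis using card_image[OF inj_on_D_single_pairs] card_W by simp
qed

text \<open>For each of the \<open>q - 1\<close> choices of \<open>u\<close>, the entry
  \<open>v\<close> avoids the two elements \<open>u\<close> and \<open>- u\<close> of
  \<open>W\<close>; every value is then hit by exactly two pairs.\<close>

lemma card_D_double_pairs: "2 * card (D ` double_pairs) = (q - 1) * (q - 3)"
proof -
  have "double_pairs = Sigma W (\<lambda>u. W - {u, - u})"
    by (auto simp: double_pairs_def)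
  moreover have "card (W - {u, - u}) = q - 3" if "u \<in> W" for u
  proof -
    have "u \<noteq> - u" using that U_nonzero neq_uminus by (auto simp: W_def)
    then show ?thesis
      using that card_W by (subst card_Diff_subset) (use uminus_in_W in auto)
  qed
  ultimately have "card double_pairs = (q - 1) * (q - 3)" by (simp add: card_W)
  moreover have "card double_pairs = (\<Sum>b\<in>D ` double_pairs. card {t \<in> double_pairs. D t = b})"
    using sum.image_gen[of double_pairs "\<lambda>_. 1::nat" D] by simp
  moreover have "card {t \<in> double_pairs. D t = b} = 2" if "b \<in> D ` double_pairs" for b
    using that D_fibre_double(2,3) by auto
  ultimately show ?thesis by simp
qed

lemma admissible_pairI: "u \<in> U \<Longrightarrow> v \<in> U \<Longrightarrow> u \<noteq> 1 \<Longrightarrow> v \<noteq> 1 \<Longrightarrow> u \<noteq> v \<Longrightarrow> (u, v) \<in> admissible_pairs"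
  by (simp add: admissible_pairs_def)

lemma U_power: "u \<in> U \<Longrightarrow> u ^ k \<in> U"
  unfolding U_def mem_Collect_eq by (metis mult.commute power_mult power_one)

section \<open>When 1 and -1 are differences of admissible pairs\<close>

text \<open>A difference 1 forces \<open>u * v = -1\<close>, hence \<open>u ^ 3 = -1\<close>. If 3
  did not divide \<open>q + 1\<close>, cubing would be injective on \<open>U\<close>, giving
  \<open>u = -1\<close> and the excluded \<open>v = 1\<close>.\<close>

lemma one_in_D_admissibleD:
  assumes "1 \<in> D ` admissible_pairs"
  shows "q mod 3 = 2"
proof (rule ccontr)
  assume "q mod 3 \<noteq> 2"
  then have "\<not> 3 dvd q + 1" by presburger
  then have "coprime 3 (q + 1)" by (intro prime_imp_coprime) auto
  obtain u v where uv: "(u, v) \<in> admissible_pairs" "u - v = 1" using assms by auto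
  then have U: "u \<in> U" "v \<in> U" "v \<noteq> 1" by (auto simp: admissible_pairs_def)
  have prod: "u * v = -1" using frobenius_diff_U[OF U(1,2)] uv(2) by simp
  have v: "v = u - 1" using uv(2) by (simp add: algebra_simps)
  \<comment> \<open>With \<open>v = u - 1\<close> the second factor is
    \<open>u ^ 2 - u + 1\<close>.\<close>
  have "u ^ 3 + 1 = (u + 1) * (u * v + 1)"
    unfolding v by (simp add: algebra_simps power3_eq_cube)
  then have "u ^ 3 = (-1) ^ 3" using prod by (simp add: eq_neg_iff_add_eq_0)
  moreover have "(-1) \<in> U" using uminus_in_U one_in_U by simp
  ultimately have "u = -1"
    using power_inj_on_roots_of_unity[OF \<open>coprime 3 (q + 1)\<close>, of u "-1"] U(1)
    unfolding U_def mem_Collect_eq by simp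
  then show False using prod \<open>v \<noteq> 1\<close> by simp
qed

text \<open>A primitive cube root of unity \<open>w\<close> lies in \<open>U\<close> because 3
  divides \<open>q + 1\<close>. The pair \<open>(- w, w ^ 2)\<close> has difference 1 since
  \<open>w ^ 2 + w + 1 = 0\<close>.\<close>

lemma one_in_D_double_pairs:
  assumes "q mod 3 = 2"
  shows "1 \<in> D ` double_pairs"
proof -
  obtain r where r: "q + 1 = 3 * r" using assms
    by (metis mod_Suc numeral_2_eq_2 numeral_3_eq_3 Suc_eq_plus1 mod_0_imp_dvd dvd_def)
  have "card {x :: 'a. x ^ 3 = 1} = 3"
    using card_field q_square_minus_one unfolding r
    by (intro card_roots_of_unity_finite_field[where d = "r * (q - 1)"]) (simp add: mult.assoc)
  then have "\<not> {x :: 'a. x ^ 3 = 1} \<subseteq> {1}"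
    using card_mono[of "{1}" "{x :: 'a. x ^ 3 = 1}"] by auto
  then obtain w :: 'a where w: "w ^ 3 = 1" "w \<noteq> 1" by auto
  have "(w - 1) * (w ^ 2 + w + 1) = w ^ 3 - 1"
    by (simp add: algebra_simps power2_eq_square power3_eq_cube)
  then have sum: "w ^ 2 + w + 1 = 0" using w by simp
  have "w ^ (q + 1) = 1" using w r by (simp only: power_mult) simp
  then have wU: "w \<in> U" by (simp add: U_def)
  then have w2U: "w ^ 2 \<in> U" by (rule U_power)
  \<comment> \<open>The value -1 is ruled out by cubing: \<open>w\<close> and \<open>w ^ 2\<close>
    have cube 1, while -1 has cube -1.\<close>
  have ne: "w \<noteq> -1" "w ^ 2 \<noteq> 1" "w ^ 2 \<noteq> -1" "w ^ 2 \<noteq> w"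
  proof -
    have w6: "(w ^ 2) ^ 3 = 1" using w by (metis power_mult mult.commute power_one)
    moreover have "(-1 :: 'a) ^ 3 \<noteq> 1" using minus_one_neq_one by simp
    ultimately show "w \<noteq> -1" "w ^ 2 \<noteq> -1" using w(1) by metis+
    show "w ^ 2 \<noteq> 1" using w by (auto simp: power3_eq_cube power2_eq_square)
    show "w ^ 2 \<noteq> w" using w by (auto simp: power3_eq_cube power2_eq_square)
  qed
  have "- w \<in> W" using wU w(2) ne(1) by (intro uminus_in_W) (simp add: W_def)
  moreover have "w ^ 2 \<in> W" using w2U ne by (simp add: W_def)
  moreover have "- w - w ^ 2 = 1" using sum
    by (metis add.commute add.assoc add_eq_0_iff diff_conv_add_uminus minus_add_distrib)
  moreover have "- w \<noteq> w ^ 2" using \<open>- w - w ^ 2 = 1\<close> by auto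
  moreover have "- w \<noteq> - (w ^ 2)" using ne by auto
  ultimately have "(- w, w ^ 2) \<in> double_pairs" by (simp add: double_pairs_def)
  then show ?thesis using \<open>- w - w ^ 2 = 1\<close> by (metis (mono_tags, lifting) case_prod_conv image_eqI)
qed

lemma minus_one_in_D_admissible_iff: "-1 \<in> D ` admissible_pairs \<longleftrightarrow> 1 \<in> D ` admissible_pairs"
proof -
  have "- b \<in> D ` admissible_pairs" if "b \<in> D ` admissible_pairs" for b
  proof -
    obtain u v where "(u, v) \<in> admissible_pairs" "b = u - v" using \<open>b \<in> D ` admissible_pairs\<close> by auto
    then show ?thesis by (intro image_eqI[of _ _ "(v, u)"]) (auto simp: admissible_pairs_def)
  qed
  from this[of 1] this[of "-1"] show ?thesis unfolding minus_minus by blast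
qed

lemma minus_one_in_D_double_pairs:
  assumes "1 \<in> D ` double_pairs"
  shows "-1 \<in> D ` double_pairs"
proof -
  obtain u v where *: "(u, v) \<in> double_pairs" "1 = u - v" using assms by auto
  have "-1 = v - u" using *(2) by (metis minus_diff_eq)
  moreover have "(v, u) \<in> double_pairs" using *(1) by (auto simp: double_pairs_def)
  ultimately show ?thesis by (intro image_eqI[of _ _ "(v, u)"]) auto
qed

section \<open>Parametrization of the complement of the subfield\<close>

lemma bij_betw_power_U:
  assumes "coprime k (q + 1)"
  shows "bij_betw (\<lambda>u. u ^ k) U U"
proof -
  have "inj_on (\<lambda>u. u ^ k) U"
    using power_inj_on_roots_of_unity[OF assms] by (auto simp: inj_on_def U_def simp del: power_Suc)
  then show ?thesis
    using U_power by (intro bij_betw_imageI endo_inj_surj) auto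
qed

lemma bij_betw_power_pairs:
  assumes "coprime k (q + 1)"
  shows "bij_betw (\<lambda>(u, v). (u ^ k, v ^ k)) admissible_pairs admissible_pairs"
proof -
  have inj: "u ^ k = v ^ k \<longleftrightarrow> u = v" if "u \<in> U" "v \<in> U" for u v
    using bij_betw_power_U[OF assms] that by (auto simp: bij_betw_def inj_on_def)
  have "u ^ k = 1 \<longleftrightarrow> u = 1" if "u \<in> U" for u
    using inj[OF that one_in_U] by simp
  then have "inj_on (\<lambda>(u, v). (u ^ k, v ^ k)) admissible_pairs"
    "(\<lambda>(u, v). (u ^ k, v ^ k)) ` admissible_pairs \<subseteq> admissible_pairs"
    using inj U_power by (auto simp: inj_on_def admissible_pairs_def)
  then show ?thesis by (intro bij_betw_imageI endo_inj_surj) auto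
qed

text \<open>With \<open>v = x ^ (q - 1)\<close> and \<open>u = (x + 1) ^ (q - 1)\<close>, additivity
  of the \<open>q\<close>-th power reads \<open>v * x + 1 = u * (x + 1)\<close>. This is linear in
  \<open>x\<close>, which yields the inverse map.\<close>

lemma bij_betw_ratios:
  "bij_betw (\<lambda>x. ((x + 1) ^ (q - 1), x ^ (q - 1))) {x. x ^ q \<noteq> x} admissible_pairs"
proof (rule bij_betw_byWitness[where f' = "\<lambda>(u, v). (u - 1) / (v - u)"])
  let ?X = "{x :: 'a. x ^ q \<noteq> x}"
  have ratio: "x \<noteq> 0" "x + 1 \<noteq> 0" "x ^ q = x ^ (q - 1) * x"
    "x ^ (q - 1) * x + 1 = (x + 1) ^ (q - 1) * (x + 1)" if "x \<in> ?X" for x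
  proof -
    have "x \<noteq> - 1" using that odd_q by auto
    then show "x \<noteq> 0" "x + 1 \<noteq> 0" using that q_ge_3 by (auto simp: zero_power add_eq_0_iff2)
    then show "x ^ q = x ^ (q - 1) * x"
      "x ^ (q - 1) * x + 1 = (x + 1) ^ (q - 1) * (x + 1)"
      using power_eq_if_neq_zero[of x] power_eq_if_neq_zero[of "x + 1"] frobenius[of x 1] by auto
  qed
  have neq: "x ^ (q - 1) \<noteq> 1" "(x + 1) ^ (q - 1) \<noteq> 1" "x ^ (q - 1) \<noteq> (x + 1) ^ (q - 1)"
    if x: "x \<in> ?X" for x
  proof -
    show n1: "x ^ (q - 1) \<noteq> 1" using ratio[OF x] x by auto
    show "(x + 1) ^ (q - 1) \<noteq> 1" using ratio[OF x] x by auto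
    show "x ^ (q - 1) \<noteq> (x + 1) ^ (q - 1)"
      using ratio(4)[OF x] n1 by (auto simp: algebra_simps)
  qed
  show "\<forall>x\<in>?X. (\<lambda>(u, v). (u - 1) / (v - u)) ((x + 1) ^ (q - 1), x ^ (q - 1)) = x"
  proof
    fix x assume x: "x \<in> ?X"
    have *: "(x + 1) ^ (q - 1) - 1 = x * (x ^ (q - 1) - (x + 1) ^ (q - 1))"
      using ratio(4)[OF x] by (simp add: algebra_simps)
    show "(\<lambda>(u, v). (u - 1) / (v - u)) ((x + 1) ^ (q - 1), x ^ (q - 1)) = x"
      unfolding prod.case * using neq(3)[OF x] by simp
  qed
  show "(\<lambda>x. ((x + 1) ^ (q - 1), x ^ (q - 1))) ` ?X \<subseteq> admissible_pairs"
  proof (rule image_subsetI)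
    fix x assume x: "x \<in> ?X"
    show "((x + 1) ^ (q - 1), x ^ (q - 1)) \<in> admissible_pairs"
      using ratio(1,2)[OF x] neq(1,2) neq(3)[OF x, symmetric] x
      by (intro admissible_pairI power_in_U)
  qed
  have root: "((u - 1) / (v - u)) ^ (q - 1) = v \<and> ((u - 1) / (v - u) + 1) ^ (q - 1) = u
      \<and> (u - 1) / (v - u) \<in> ?X" if "(u, v) \<in> admissible_pairs" for u v
  proof -
    from that have U: "u \<in> U" "v \<in> U" and ne: "u \<noteq> 1" "v \<noteq> 1" "u \<noteq> v"
      by (auto simp: admissible_pairs_def)
    have nz: "u \<noteq> 0" "v \<noteq> 0" using U U_nonzero by auto
    define x where "x = (u - 1) / (v - u)"
    have x1: "x + 1 = (v - 1) / (v - u)" using ne by (simp add: x_def field_simps)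
    \<comment> \<open>On \<open>U\<close> the \<open>q\<close>-th power is inversion, so
      \<open>x ^ q\<close> and \<open>(x + 1) ^ q\<close> become rational expressions in
      \<open>u\<close> and \<open>v\<close>.\<close>
    have d: "(v - u) ^ q = (u - v) / (u * v)"
      using nz U by (simp add: frobenius_diff U_inverse field_simps)
    have "x ^ q = v * x"
      unfolding x_def power_divide d using nz ne U by (simp add: frobenius_diff U_inverse field_simps)
    have "(x + 1) ^ q = u * (x + 1)"
      unfolding x1 power_divide d using nz ne U by (simp add: frobenius_diff U_inverse field_simps)
    have "x \<noteq> 0" using ne by (simp add: x_def)
    have "x + 1 \<noteq> 0" using ne by (simp add: x1)
    have "x ^ (q - 1) = v"
      using power_eq_if_neq_zero[OF \<open>x \<noteq> 0\<close>] \<open>x ^ q = v * x\<close> \<open>x \<noteq> 0\<close> by simp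
    moreover have "(x + 1) ^ (q - 1) = u"
      using power_eq_if_neq_zero[OF \<open>x + 1 \<noteq> 0\<close>] \<open>(x + 1) ^ q = u * (x + 1)\<close> \<open>x + 1 \<noteq> 0\<close> by simp
    moreover have "x ^ q \<noteq> x" using \<open>x ^ q = v * x\<close> \<open>x \<noteq> 0\<close> ne by simp
    ultimately show ?thesis by (simp add: x_def)
  qed
  show "\<forall>s\<in>admissible_pairs. (\<lambda>x. ((x + 1) ^ (q - 1), x ^ (q - 1))) ((\<lambda>(u, v). (u - 1) / (v - u)) s) = s"
    using root by auto
  show "(\<lambda>(u, v). (u - 1) / (v - u)) ` admissible_pairs \<subseteq> ?X"
    using root by auto
qed

lemma card_fibre_single: "b \<in> D ` single_pairs \<Longrightarrow> card {s \<in> admissible_pairs. D s = b} = 1"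
  using D_fibre_single by auto

lemma card_fibre_double: "b \<in> D ` double_pairs \<Longrightarrow> card {s \<in> admissible_pairs. D s = b} = 2"
  using D_fibre_double(1,3) by auto

lemma card_fibre_neither:
  "b \<notin> D ` single_pairs \<Longrightarrow> b \<notin> D ` double_pairs \<Longrightarrow> card {s \<in> admissible_pairs. D s = b} = 0"
  using admissible_pairs_eq by auto

lemma power_pred_eq_one:
  assumes "(x :: 'a) ^ q = x" "x \<noteq> 0"
  shows "x ^ (q - 1) = 1"
  using assms power_eq_if_neq_zero[of x] by simp

text \<open>Opaque names: with \<open>D ` single_pairs\<close> in the goal, automation unfolds membership in the image.\<close>
definition single_values :: "'a set" where "single_values = D ` single_pairs"
definition double_values :: "'a set" where "double_values = D ` double_pairs"

lemmas values_disjoint = D_image_disjoint[folded single_values_def double_values_def]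
  and card_single_values = card_D_single_pairs[folded single_values_def]
  and card_double_values = card_D_double_pairs[folded double_values_def]
  and fibre_single_value = card_fibre_single[folded single_values_def]
  and fibre_double_value = card_fibre_double[folded double_values_def]
  and fibre_neither = card_fibre_neither[folded single_values_def double_values_def]

lemma zero_neq_pm_one: "(0 :: 'a) \<noteq> 1" "(0 :: 'a) \<noteq> -1"
  by simp_all

lemma D_admissible_pairs: "D ` admissible_pairs = single_values \<union> double_values"
  unfolding admissible_pairs_eq single_values_def double_values_def by (rule image_Un)

lemma pm_one_double_value: "q mod 3 = 2 \<Longrightarrow> 1 \<in> double_values \<and> -1 \<in> double_values"
  unfolding double_values_def using one_in_D_double_pairs minus_one_in_D_double_pairs by blast

lemma pm_one_no_value: "q mod 3 \<noteq> 2 \<Longrightarrow> 1 \<notin> single_values \<union> double_values \<and> -1 \<notin> single_values \<union> double_values"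
  unfolding D_admissible_pairs[symmetric] using one_in_D_admissibleD minus_one_in_D_admissible_iff by blast

subsection \<open>The differential spectrum\<close>

context
  fixes k :: nat and F :: "'a \<Rightarrow> 'a"
  assumes k: "k > 0" "coprime k (q + 1)"
    and F: "F = (\<lambda>x. x ^ (k * (q - 1)))"
begin

lemma F_power: "F x = (x ^ (q - 1)) ^ k"
  unfolding F by (metis mult.commute power_mult)

text \<open>The exponent is positive, so \<open>F 0 = 0\<close>; nonzero elements of the subfield
  are \<open>(q - 1)\<close>-th roots of unity.\<close>

lemma F_subfield: "x ^ q = x \<Longrightarrow> F x = (if x = 0 then 0 else 1)"
  using power_pred_eq_one[of x] k q_ge_3 by (auto simp: F_power zero_power)

lemma bij_betw_F: "bij_betw (\<lambda>x. (F (x + 1), F x)) {x. x ^ q \<noteq> x} admissible_pairs"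
proof -
  have "(\<lambda>(u, v). (u ^ k, v ^ k)) \<circ> (\<lambda>x. ((x + 1) ^ (q - 1), x ^ (q - 1))) = (\<lambda>x. (F (x + 1), F x))"
    by (simp add: fun_eq_iff F_power)
  then show ?thesis
    using bij_betw_trans[OF bij_betw_ratios bij_betw_power_pairs[OF k(2)]] by simp
qed

lemma F_diff_subfield:
  assumes "x ^ q = x"
  shows "F (x + 1) - F x = (if x = 0 then 1 else if x = -1 then -1 else 0)"
proof -
  have "(x + 1) ^ q = x + 1" using assms frobenius[of x 1] by simp
  then show ?thesis
    using F_subfield[OF assms] F_subfield[of "x + 1"] by (auto simp: add_eq_0_iff2)
qed

lemma zero_minus_one_subfield: "0 ^ q = (0 :: 'a)" "(-1) ^ q = (-1 :: 'a)"
  using q_ge_3 odd_q by (auto simp: zero_power)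

text \<open>Outside the subfield the two values of \<open>F\<close> form an admissible pair and so
  differ; inside it, only 0 and -1 fail to be solutions.\<close>

lemma delta_count_zero: "delta_count F 1 0 = q - 2"
proof -
  have "F (x + 1) - F x = 0 \<longleftrightarrow> x ^ q = x \<and> x \<noteq> 0 \<and> x \<noteq> -1" for x
  proof (cases "x ^ q = x")
    case True
    then show ?thesis unfolding F_diff_subfield[OF True] using True by simp
  next
    case False
    then have "(F (x + 1), F x) \<in> admissible_pairs" using bij_betwE[OF bij_betw_F] by blast
    then show ?thesis using False by (simp add: admissible_pairs_def)
  qed
  then have "{x. F (x + 1) - F x = 0} = {x. x ^ q = x} - {0, -1}" by auto
  then show ?thesis
    unfolding delta_count_def using zero_minus_one_subfield
    by (simp add: card_Diff_subset card_subfield)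
qed

text \<open>Solutions outside the subfield correspond to the fibre of \<open>D\<close> over
  \<open>b\<close>. The subfield adds \<open>x = 0\<close> for \<open>b = 1\<close> and
  \<open>x = -1\<close> for \<open>b = -1\<close>.\<close>

lemma delta_count_nonzero:
  assumes "b \<noteq> 0"
  shows "delta_count F 1 b = card {s \<in> admissible_pairs. D s = b} + of_bool (b = 1 \<or> b = -1)"
proof -
  let ?X = "{x \<in> {x. x ^ q \<noteq> x}. F (x + 1) - F x = b}"
  let ?Y = "{x. x ^ q = x \<and> F (x + 1) - F x = b}"
  have "(\<lambda>x. (F (x + 1), F x)) ` ?X = {s \<in> admissible_pairs. D s = b}"
    unfolding bij_betw_imp_surj_on[OF bij_betw_F, symmetric] by auto
  then have "bij_betw (\<lambda>x. (F (x + 1), F x)) ?X {s \<in> admissible_pairs. D s = b}"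
    by (intro bij_betw_subset[OF bij_betw_F]) auto
  then have X: "card ?X = card {s \<in> admissible_pairs. D s = b}" by (rule bij_betw_same_card)
  have "x ^ q = x \<and> F (x + 1) - F x = b \<longleftrightarrow> b = 1 \<and> x = 0 \<or> b = -1 \<and> x = -1" for x
    using F_diff_subfield[of x] assms zero_minus_one_subfield minus_one_neq_one by metis
  then have "?Y = (if b = 1 then {0} else if b = -1 then {-1} else {})"
    using minus_one_neq_one by auto
  then have Y: "card ?Y = of_bool (b = 1 \<or> b = -1)" by simp
  have "{x. F (x + 1) - F x = b} = ?X \<union> ?Y" by auto
  then have "card {x. F (x + 1) - F x = b} = card ?X + card ?Y"
    by (simp add: card_Un_disjoint Int_def)
  then show ?thesis unfolding delta_count_def X Y .
qed

lemma zero_notin_values: "0 \<notin> single_values" "0 \<notin> double_values"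
  using zero_notin_D_image unfolding D_admissible_pairs by blast+

lemma delta_generic:
  assumes "b \<noteq> 0" "b \<noteq> 1" "b \<noteq> -1"
  shows "b \<in> single_values \<Longrightarrow> delta_count F 1 b = 1"
    and "b \<in> double_values \<Longrightarrow> delta_count F 1 b = 2"
    and "b \<notin> single_values \<Longrightarrow> b \<notin> double_values \<Longrightarrow> delta_count F 1 b = 0"
  using delta_count_nonzero[OF assms(1)] assms(2,3) fibre_single_value[of b] fibre_double_value[of b]
    fibre_neither[of b]
  by simp_all

section \<open>Assembling the spectrum and the local APN property\<close>

text \<open>The count \<open>q - 2\<close> is attained at \<open>b = 0\<close>, so the uniformity is
  \<open>q - 2\<close> once no block exceeds it. Only nonempty blocks are bounded: for
  \<open>q = 3\<close> the index 2 is larger than \<open>q - 2\<close>, but its block is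
  empty.\<close>

lemma spectrum_from_blocks:
  assumes "sorted_wrt (\<lambda>(i, A) (j, B). A \<inter> B = {}) bs"
    and blocks: "\<And>j A b. (j, A) \<in> set bs \<Longrightarrow> b \<in> A \<Longrightarrow> delta_count F 1 b = j"
    and cover: "\<Union>(snd ` set bs) = UNIV"
    and bound: "\<And>j A. (j, A) \<in> set bs \<Longrightarrow> A \<noteq> {} \<Longrightarrow> j \<le> q - 2"
  shows "differential_spectrum F = displayed_spectrum (q - 2) (map (\<lambda>(j, A). (j, card A)) bs)"
proof (rule differential_spectrum_eq_displayed_spectrum[OF _ assms(1) blocks cover])
  have "delta_count F 1 b \<le> q - 2" for b
  proof -
    have "b \<in> \<Union>(snd ` set bs)" using cover by simp
    then obtain j A where "(j, A) \<in> set bs" "b \<in> A" by auto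
    then show ?thesis using blocks[of j A b] bound[of j A] by auto
  qed
  then show "differential_uniformity F = q - 2"
    using differential_uniformity_power[OF delta_count_zero[unfolded F]] unfolding F by blast
qed

text \<open>Writing the odd \<open>q\<close> as \<open>2 * s + 3\<close> turns the truncated
  subtractions and the halving in the displayed entries into polynomials in
  \<open>s\<close>.\<close>

lemma q_parametrization:
  obtains s where "q = 2 * s + 3" "card double_values = 2 * s * (s + 1)" "card single_values = 6 * (s + 1)"
proof -
  have "q = 2 * ((q - 3) div 2) + 3" using odd_q q_ge_3 by presburger
  then obtain s where s: "q = 2 * s + 3" by blast
  then show ?thesis using that[of s] card_single_values card_double_values by simp
qed

lemma spectrum_2_mod_3:
  assumes "q mod 3 = 2"
  shows "differential_spectrum F = displayed_spectrum (q - 2)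
    [(0, (q ^ 2 - 1) div 2 - (q - 1)), (1, 3 * (q - 1)), (2, (q ^ 2 - 1) div 2 - 2 * q),
     (3, 2), (q - 2, 1)]"
proof -
  let ?Z = "UNIV - (single_values \<union> (double_values \<union> {0}))"
  \<comment> \<open>Here 1 and -1 are double values, and the extra subfield solution raises their
    count to 3.\<close>
  let ?bs = "[(0, ?Z), (1, single_values), (2, double_values - {1, -1}), (3, {1, -1}), (q - 2, {0})]"
  have pm: "1 \<in> double_values" "-1 \<in> double_values"
    using pm_one_double_value[OF assms] by auto
  then have pm': "1 \<notin> single_values" "-1 \<notin> single_values"
    using values_disjoint by blast+
  have "q \<noteq> 3" "q \<noteq> 4" using assms by auto
  then have q5: "q \<ge> 5" using q_ge_3 by simp
  have three: "delta_count F 1 1 = 3" "delta_count F 1 (-1) = 3"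
    using delta_count_nonzero[of 1] delta_count_nonzero[of "-1"] fibre_double_value pm by simp_all
  have blocks: "delta_count F 1 b = j" if mem: "(j, A) \<in> set ?bs" "b \<in> A" for j A b
  proof -
    consider "j = 0" "b \<in> ?Z" | "j = 1" "b \<in> single_values" | "j = 2" "b \<in> double_values - {1, -1}"
      | "j = 3" "b = 1 \<or> b = -1" | "j = q - 2" "b = 0"
      using mem by auto
    then show ?thesis
    proof cases
      case 1
      then show ?thesis unfolding 1(1) using delta_generic(3)[of b] pm by blast
    next
      case 2
      then show ?thesis using delta_generic(1)[of b] pm' zero_notin_values by metis
    next
      case 3
      then have "b \<in> double_values" "b \<noteq> 1" "b \<noteq> -1" by blast+
      then show ?thesis unfolding 3(1) using delta_generic(2)[of b] zero_notin_values by metis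
    next
      case 4
      then show ?thesis using three by blast
    next
      case 5
      then show ?thesis using delta_count_zero by simp
    qed
  qed
  have cover: "\<Union>(snd ` set ?bs) = UNIV" using pm by auto
  have bound: "j \<le> q - 2" if "(j, A) \<in> set ?bs" for j A
    using that q5 by auto
  have "sorted_wrt (\<lambda>(i, A) (j, B). A \<inter> B = {}) ?bs"
    using values_disjoint zero_notin_values pm by (rule disjoint_blocks_special_in_Y)
  then have spectrum: "differential_spectrum F = displayed_spectrum (q - 2) (map (\<lambda>(j, A). (j, card A)) ?bs)"
    by (rule spectrum_from_blocks[OF _ blocks cover bound])
  obtain s where s: "q = 2 * s + 3" "card double_values = 2 * s * (s + 1)" "card single_values = 6 * (s + 1)"
    by (rule q_parametrization)
  have half: "(q ^ 2 - 1) div 2 = 2 * s ^ 2 + 6 * s + 4" "q ^ 2 = 4 * s ^ 2 + 12 * s + 9"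
    by (simp_all add: s power2_eq_square algebra_simps)
  have "card ?Z = q ^ 2 - (card single_values + (card double_values + 1))"
    using values_disjoint zero_notin_values card_field by (simp add: card_Diff_subset card_Un_disjoint)
  then have "card ?Z = 2 * s ^ 2 + 4 * s + 2"
    unfolding half s(2,3) by (simp add: power2_eq_square algebra_simps)
  then have "card ?Z = (q ^ 2 - 1) div 2 - (q - 1)"
    unfolding half by (simp add: s)
  moreover have "card single_values = 3 * (q - 1)" by (rule card_single_values)
  moreover have "card (double_values - {1, -1}) = (q ^ 2 - 1) div 2 - 2 * q"
    using pm minus_one_neq_one unfolding half
    by (simp add: card_Diff_subset s(2)) (simp add: s(1) power2_eq_square algebra_simps)
  moreover have "card {1, -1 :: 'a} = 2" using minus_one_neq_one by simp
  ultimately show ?thesis using spectrum by simp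
qed

lemma spectrum_not_2_mod_3:
  assumes "q mod 3 \<noteq> 2"
  shows "differential_spectrum F = displayed_spectrum (q - 2)
    [(0, (q ^ 2 - 1) div 2 - (q + 1)), (1, 3 * q - 1), (2, (q ^ 2 - 1) div 2 - 2 * (q - 1)),
     (q - 2, 1)]"
proof -
  let ?Z = "UNIV - (single_values \<union> (double_values \<union> {0, 1, -1}))"
  \<comment> \<open>Here 1 and -1 are not values of \<open>D\<close> on admissible pairs; their only
    solution comes from the subfield, so they join the block of index 1.\<close>
  let ?bs = "[(0, ?Z), (1, single_values \<union> {1, -1}), (2, double_values), (q - 2, {0})]"
  have pm: "1 \<notin> single_values" "-1 \<notin> single_values" "1 \<notin> double_values" "-1 \<notin> double_values"
    using pm_one_no_value[OF assms] by auto
  obtain s where s: "q = 2 * s + 3" "card double_values = 2 * s * (s + 1)" "card single_values = 6 * (s + 1)"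
    by (rule q_parametrization)
  have one: "delta_count F 1 1 = 1" "delta_count F 1 (-1) = 1"
    using delta_count_nonzero[of 1] delta_count_nonzero[of "-1"] fibre_neither pm by simp_all
  have blocks: "delta_count F 1 b = j" if mem: "(j, A) \<in> set ?bs" "b \<in> A" for j A b
  proof -
    consider "j = 0" "b \<in> ?Z" | "j = 1" "b \<in> single_values" | "j = 2" "b \<in> double_values"
      | "j = 1" "b = 1 \<or> b = -1" | "j = q - 2" "b = 0"
      using mem by auto
    then show ?thesis
    proof cases
      case 1
      then show ?thesis unfolding 1(1) using delta_generic(3)[of b] by blast
    next
      case 2
      then show ?thesis using delta_generic(1)[of b] pm zero_notin_values by metis
    next
      case 3
      then show ?thesis using delta_generic(2)[of b] pm zero_notin_values by metis
    next
      case 4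
      then show ?thesis using one by blast
    next
      case 5
      then show ?thesis using delta_count_zero by simp
    qed
  qed
  have cover: "\<Union>(snd ` set ?bs) = UNIV" by auto
  \<comment> \<open>The case \<open>s = 0\<close> is \<open>q = 3\<close>, where index 2 exceeds
    \<open>q - 2\<close>.\<close>
  have "double_values = {}" if "s = 0" using that s(2) by simp
  then have bound: "j \<le> q - 2" if "(j, A) \<in> set ?bs" "A \<noteq> {}" for j A
    using that s(1) by (cases "s = 0") auto
  have "sorted_wrt (\<lambda>(i, A) (j, B). A \<inter> B = {}) ?bs"
    using values_disjoint zero_notin_values pm(3,4) zero_neq_pm_one by (rule disjoint_blocks_special_outside)
  then have spectrum: "differential_spectrum F = displayed_spectrum (q - 2) (map (\<lambda>(j, A). (j, card A)) ?bs)"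
    by (rule spectrum_from_blocks[OF _ blocks cover bound])
  have half: "(q ^ 2 - 1) div 2 = 2 * s ^ 2 + 6 * s + 4" "q ^ 2 = 4 * s ^ 2 + 12 * s + 9"
    by (simp_all add: s power2_eq_square algebra_simps)
  have "card (double_values \<union> {0, 1, -1}) = card double_values + card {0, 1, -1 :: 'a}"
    using pm zero_notin_values by (intro card_Un_disjoint) auto
  then have "card (double_values \<union> {0, 1, -1}) = card double_values + 3"
    using minus_one_neq_one zero_neq_pm_one by simp
  moreover have "card (single_values \<union> (double_values \<union> {0, 1, -1}))
      = card single_values + card (double_values \<union> {0, 1, -1})"
    using pm zero_notin_values values_disjoint by (intro card_Un_disjoint) auto
  ultimately have "card ?Z = q ^ 2 - (card single_values + (card double_values + 3))"
    using card_field by (simp only: card_Diff_subset[OF finite subset_UNIV])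
  then have "card ?Z = 2 * s ^ 2 + 4 * s"
    unfolding half s(2,3) by (simp add: power2_eq_square algebra_simps)
  then have "card ?Z = (q ^ 2 - 1) div 2 - (q + 1)"
    unfolding half by (simp add: s)
  moreover have "card (single_values \<union> {1, -1}) = 3 * q - 1"
    using pm minus_one_neq_one s by (simp add: card_Un_disjoint)
  moreover have "card double_values = (q ^ 2 - 1) div 2 - 2 * (q - 1)"
    unfolding half s(2) by (simp add: s(1) power2_eq_square algebra_simps)
  ultimately show ?thesis using spectrum by simp
qed

text \<open>Counts above 2 can occur only at 0, 1 and -1, which lie in the prime field, so it
  remains to find a double value outside it. For \<open>q = 3\<close> there are no double values and
  the maximum stays below 2.\<close>

lemma locally_APN:
  assumes "q \<noteq> 3"
  shows "locally_APN F"
proof -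
  have q5: "q \<ge> 5" using assms q_ge_3 odd_q by presburger
  have "W \<noteq> {}" using card_W q5 by auto
  then obtain u where u: "u \<in> W" by blast
  \<comment> \<open>Avoiding \<open>u\<close> and \<open>- u\<close> makes the pair double; avoiding
    \<open>- inverse u\<close> gives \<open>u * v \<noteq> -1\<close>, which keeps
    \<open>u - v\<close> out of the subfield with \<open>q\<close> elements. \<open>W\<close> has at
    least 4 elements.\<close>
  have "card {u, - u, - inverse u} < card W"
    using card_W q5 by (intro le_less_trans[OF card_insert_le_m1[of 3]]) (auto simp: card_insert_if)
  then have "\<not> W \<subseteq> {u, - u, - inverse u}" by (metis card_mono finite.emptyI finite.insertI leD)
  then obtain v where v: "v \<in> W" "v \<noteq> u" "v \<noteq> - u" "v \<noteq> - inverse u" by blast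
  let ?b = "u - v"
  have "(u, v) \<in> double_pairs" using u v by (auto simp: double_pairs_def)
  then have b: "?b \<in> double_values" unfolding double_values_def by force
  have "?b \<notin> \<int>"
  proof
    assume "?b \<in> \<int>"
    then have "?b ^ q = ?b" using Ints_subset_subfield by blast
    then have "?b * (u * v) = ?b * (-1)" using frobenius_diff_U[of u v] W_D u v(1) by simp
    then have "u * v = -1" using v(2) by (subst (asm) mult_cancel_left) auto
    then show False using v(4) inverse_unique[of u "- v"] by auto
  qed
  have ints: "0 \<in> (\<int> :: 'a set)" "1 \<in> (\<int> :: 'a set)" "-1 \<in> (\<int> :: 'a set)" by simp_all
  have "(MAX b\<in>UNIV - \<int>. delta_count F 1 b) = 2"
  proof (rule Max_eqI)
    fix n assume "n \<in> delta_count F 1 ` (UNIV - \<int>)"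
    then obtain b where "b \<notin> \<int>" "n = delta_count F 1 b" by blast
    moreover from this have "b \<noteq> 0" "b \<noteq> 1" "b \<noteq> -1" using ints by metis+
    then have "delta_count F 1 b = 0 \<or> delta_count F 1 b = 1 \<or> delta_count F 1 b = 2"
      using delta_generic[of b] by blast
    ultimately show "n \<le> 2" by auto
  next
    have "delta_count F 1 ?b = 2" using delta_generic(2)[OF _ _ _ b] \<open>?b \<notin> \<int>\<close> ints by metis
    then show "2 \<in> delta_count F 1 ` (UNIV - \<int>)" using \<open>?b \<notin> \<int>\<close> by (metis DiffI UNIV_I imageI)
  qed simp
  then show ?thesis by (simp add: locally_APN_def)
qed

end

end

theorem theorem3:
  fixes F :: "'a::{field,finite} \<Rightarrow> 'a" and p m k q :: nat
  assumes "prime p" and "odd p" and "m > 0" and "k > 0"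
    and "q = p ^ m"
    and "card (UNIV :: 'a set) = q ^ 2"
    and "coprime k (q + 1)"
    and "F = (\<lambda>x. x ^ (k * (q - 1)))"
  shows "(q \<noteq> 3 \<longrightarrow> locally_APN F) \<and>
    (q mod 3 = 2 \<longrightarrow>
      differential_spectrum F = displayed_spectrum (q - 2)
        [(0, (q ^ 2 - 1) div 2 - (q - 1)), (1, 3 * (q - 1)), (2, (q ^ 2 - 1) div 2 - 2 * q),
         (3, 2), (q - 2, 1)]) \<and>
    (q mod 3 \<noteq> 2 \<longrightarrow>
      differential_spectrum F = displayed_spectrum (q - 2)
        [(0, (q ^ 2 - 1) div 2 - (q + 1)), (1, 3 * q - 1), (2, (q ^ 2 - 1) div 2 - 2 * (q - 1)),
         (q - 2, 1)])"
proof -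
  have "p \<ge> 3" using prime_ge_2_nat[OF assms(1)] assms(2) by (cases "p = 2") auto
  moreover have "p ^ 1 \<le> p ^ m" using assms(3) \<open>p \<ge> 3\<close> by (intro power_increasing) auto
  ultimately have "q \<ge> 3" using assms(5) by simp
  interpret quadratic_extension q "{u :: 'a. u ^ (q + 1) = 1}"
  proof unfold_locales
    show "(x + y) ^ q = x ^ q + y ^ q" for x y :: 'a
      using finite_field_frobenius[OF assms(1)] assms(5,6) by blast
  qed (use assms \<open>q \<ge> 3\<close> in auto)
  show ?thesis
    using locally_APN spectrum_2_mod_3 spectrum_not_2_mod_3 assms(4,7,8) by blast
qed

end
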